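(* Let $\boldsymbol\theta=(\theta_1,\ldots,\theta_{n+1})^{\mathsf T}$, $n\ge2$, be a grid $-\pi=\theta_1<\cdots<\theta_{n+1}=\pi$. The connection matrix $R_{(-1)}^{(0),\boldsymbol\theta}$, defined by $\mathbf P^{(-1),\boldsymbol\theta}=\mathbf P^{(0),\boldsymbol\theta}R_{(-1)}^{(0),\boldsymbol\theta}$, and the mass matrix $M^{(-1),\boldsymbol\theta}=[\mathbf P^{(-1),\boldsymbol\theta}]^{\mathsf T}\mathbf P^{(-1),\boldsymbol\theta}$ are $CB^3(1,1;1,0)$ and $CB^3(2,2;1,0)$ matrices, respectively.
   Context: Semiclassical Jacobi polynomials: for $t>1$, $a,b>-1$, $c\in\mathbb R$, $P_k^{t,(a,b,c)}$ ($k\ge0$, degree exactly $k$) are the orthogonal polynomials on $[0,1]$ with weight $x^a(1-x)^b(t-x)^c$, normalised so that $P_0=1$ and all have the same norm as $1$. For $b=-1$: $P_0^{t,(a,-1,c)}=1$, $P_k^{t,(a,-1,c)}(x)=(1-x)P_{k-1}^{t,(a,1,c)}(x)$, $k\ge1$. Arc polynomials: with $|h|<1$, $\tau=2/(1-h)$, $\sigma=(\cos\theta-1)/(h-1)$: $p_k^{(b,h)}(\theta)=P_k^{\tau,(-1/2,b,-1/2)}(\sigma)$ ($k\ge0$), $q_k^{(b,h)}(\theta)=\sin\theta\,P_{k-1}^{\tau,(1/2,b,1/2)}(\sigma)$ ($k\ge1$). Piecewise bases: $E_i=[\theta_i,\theta_{i+1}]$, $\ell_i=\theta_{i+1}-\theta_i$,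 $\varphi_i=\ell_i/2$, $h_i=\cos\varphi_i$, $a_i(\theta)=\theta-(\theta_i+\theta_{i+1})/2$ ($i=1,\ldots,n$), index $0$ identified with $n$. $P_{m1;i}^{(b),\boldsymbol\theta}=q_m^{(b,h_i)}\circ a_i$ ($m\ge1$), $P_{m2;i}^{(b),\boldsymbol\theta}=p_m^{(b,h_i)}\circ a_i$ ($m\ge0$) on $E_i$ and $0$ elsewhere; $\mathbf P_{mj}^{(b),\boldsymbol\theta}=[P_{mj;1}^{(b),\boldsymbol\theta}\cdots P_{mj;n}^{(b),\boldsymbol\theta}]$; $\mathbf P^{(0),\boldsymbol\theta}=[\mathbf P_{02}^{(0),\boldsymbol\theta}\ \mathbf P_{11}^{(0),\boldsymbol\theta}\ \mathbf P_{12}^{(0),\boldsymbol\theta}\ \mathbf P_{21}^{(0),\boldsymbol\theta}\ \mathbf P_{22}^{(0),\boldsymbol\theta}\cdots]$, $\mathbf P^{(-1),\boldsymbol\theta}=[\mathbf H\ \ \mathbf P_{12}^{(-1),\boldsymbol\theta}\ \mathbf P_{21}^{(-1),\boldsymbol\theta}\ \mathbf P_{22}^{(-1),\boldsymbol\theta}\ \mathbf P_{31}^{(-1),\boldsymbol\theta}\cdots]$, $\mathbf H=[\phi_1\cdots\phi_n]$, where $\phi_i$ equals $\tfrac12(1+\sin a_{i-1}(\theta)/\sin\varphi_{i-1})$ on $E_{i-1}$, $\tfrac12(1-\sin a_i(\theta)/\sin\varphi_i)$ on $E_i$, $0$ elsewhere ($E_0=E_n$). Equalities of functions are understood on element interiors.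 $[\mathbf P]^{\mathsf T}\mathbf Q$ denotes the matrix of $L^2(-\pi,\pi)$ inner products $\int_{-\pi}^{\pi}P_iQ_j\,d\theta$. All matrices are infinite and partitioned into $n\times n$ blocks, where block indices associated with $\mathbf P^{(0),\boldsymbol\theta}$ (the block rows of $R_{(-1)}^{(0),\boldsymbol\theta}$) follow the ordering $\mathbf P_{02}^{(0),\boldsymbol\theta},\mathbf P_{11}^{(0),\boldsymbol\theta},\mathbf P_{12}^{(0),\boldsymbol\theta},\mathbf P_{21}^{(0),\boldsymbol\theta},\mathbf P_{22}^{(0),\boldsymbol\theta},\ldots$, and block indices associated with $\mathbf P^{(-1),\boldsymbol\theta}$ (the block columns of $R_{(-1)}^{(0),\boldsymbol\theta}$, and both the block rows and block columns of $M^{(-1),\boldsymbol\theta}$) follow the ordering $\mathbf H,\mathbf P_{12}^{(-1),\boldsymbol\theta},\mathbf P_{21}^{(-1),\boldsymbol\theta},\mathbf P_{22}^{(-1),\boldsymbol\theta},\mathbf P_{31}^{(-1),\boldsymbol\theta},\ldots$. Cyclic banded: $A\in\mathbb R^{n\times n}$ is cyclic banded with sub-bandwidths $(\ell,u)$ if $a_{ij}=0$ whenever $i-j>\ell$ or $j-i>u$, except possibly when $n-i+j\le u$ or $n+i-j\le\ell$. $CB^3(\ell,u;\lambda,\mu)$ matrix (with $n\times n$ blocks, finitely or infinitely many): block-banded with block-bandwidths $(\ell,u)$ (block $(I,J)$ vanishes unless $-\ell\le J-I\le u$); top-left block cyclic banded with sub-bandwidths $(\lambda+\mu,\lambda+\mu)$;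 remaining blocks of the first block row cyclic banded with sub-bandwidths $(\lambda,\mu)$; remaining blocks of the first block column cyclic banded with sub-bandwidths $(\mu,\lambda)$; all other blocks diagonal. *)

theory Defs
  imports "HOL-Analysis.Analysis" "HOL-Computational_Algebra.Polynomial"
begin

section \<open>Semiclassical Jacobi polynomials\<close>

definition sj_inner :: "real \<Rightarrow> real \<Rightarrow> real \<Rightarrow> real \<Rightarrow> real poly \<Rightarrow> real poly \<Rightarrow> real" where
  "sj_inner t a b c p q =
     (LBINT x:{0..1}. poly p x * poly q x * (x powr a * (1 - x) powr b * (t - x) powr c))"

definition sj_orthogonal :: "real \<Rightarrow> real \<Rightarrow> real \<Rightarrow> real \<Rightarrow> (nat \<Rightarrow> real poly) \<Rightarrow> bool" where
  "sj_orthogonal t a b c P \<longleftrightarrow>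
     (\<forall>k. degree (P k) = k) \<and>
     (\<forall>j k. j \<noteq> k \<longrightarrow> sj_inner t a b c (P j) (P k) = 0) \<and>
     P 0 = 1 \<and>
     (\<forall>k. sj_inner t a b c (P k) (P k) = sj_inner t a b c 1 1)"

text \<open>The normalisation determines each polynomial of positive degree only up to its sign.
  A family \<open>P\<close> satisfying the following predicate is an arbitrary choice of these signs,
  for all parameters at once; \<open>P t a b c k\<close> is the polynomial of degree \<open>k\<close> with
  parameters \<open>t, (a, b, c)\<close>.\<close>

definition semiclassical_jacobi ::
  "(real \<Rightarrow> real \<Rightarrow> real \<Rightarrow> real \<Rightarrow> nat \<Rightarrow> real poly) \<Rightarrow> bool" where
  "semiclassical_jacobi P \<longleftrightarrow>
     (\<forall>t a b c. t > 1 \<and> a > -1 \<and> b > -1 \<longrightarrow> sj_orthogonal t a b c (P t a b c)) \<and>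
     (\<forall>t a c. t > 1 \<and> a > -1 \<longrightarrow>
        P t a (-1) c 0 = 1 \<and>
        (\<forall>k\<ge>1. P t a (-1) c k = [:1, -1:] * P t a 1 c (k - 1)))"

lemma sj_integrable:
  fixes a b c t :: real
  assumes "t > 1" "a > -1" "b > -1"
  shows "set_integrable lborel {0..1}
    (\<lambda>x. poly p x * (x powr a * (1 - x) powr b * (t - x) powr c))"
proof -
  have "(\<lambda>x::real. x powr a * (1 - x) powr b) absolutely_integrable_on {0..1}"
    using has_integral_Beta_real[of "a + 1" "b + 1"] assms
    by (intro nonnegative_absolutely_integrable_1) (auto simp: has_integral_iff)
  then have 1: "set_integrable lborel {0..1} (\<lambda>x::real. x powr a * (1 - x) powr b)"
    unfolding set_integrable_def by (subst (asm) integrable_completion) auto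
  have "continuous_on {0..1} (\<lambda>x. poly p x * (t - x) powr c)"
    using assms by (auto intro!: continuous_intros)
  then have "bounded ((\<lambda>x. poly p x * (t - x) powr c) ` {0..1})"
    by (intro compact_imp_bounded compact_continuous_image) auto
  then obtain B where B: "\<And>x. x \<in> {0..1} \<Longrightarrow> \<bar>poly p x * (t - x) powr c\<bar> \<le> B"
    unfolding bounded_iff by (metis imageI real_norm_def)
  from 1 have "set_integrable lborel {0..1} (\<lambda>x::real. B * (x powr a * (1 - x) powr b))"
    by simp
  then show ?thesis
  proof (rule set_integrable_bound)
    show "set_borel_measurable lborel {0..1} (\<lambda>x. poly p x * (x powr a * (1 - x) powr b * (t - x) powr c))"
      unfolding set_borel_measurable_def
      by (intro borel_measurable_scaleR borel_measurable_times borel_measurable_indicator) 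
         (auto intro!: borel_measurable_continuous_onI continuous_intros)
    show "AE x in lborel. x \<in> {0..1} \<longrightarrow>
       norm (poly p x * (x powr a * (1 - x) powr b * (t - x) powr c)) \<le> norm (B * (x powr a * (1 - x) powr b))"
    proof (intro AE_I2 impI)
      fix x :: real assume x: "x \<in> {0..1}"
      have "norm (poly p x * (x powr a * (1 - x) powr b * (t - x) powr c))
         = \<bar>poly p x * (t - x) powr c\<bar> * (x powr a * (1 - x) powr b)"
        by (simp add: abs_mult)
      also have "\<dots> \<le> B * (x powr a * (1 - x) powr b)"
        by (intro mult_right_mono B x) auto
      also have "\<dots> \<le> norm (B * (x powr a * (1 - x) powr b))" by simp
      finally show "norm (poly p x * (x powr a * (1 - x) powr b * (t - x) powr c)) \<le> norm (B * (x powr a * (1 - x) powr b))" .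
    qed
  qed
qed

lemma sj_inner_commute: "sj_inner t a b c p q = sj_inner t a b c q p"
  by (simp add: sj_inner_def mult.commute)

lemma sj_inner_add_left:
  assumes "t > 1" "a > -1" "b > -1"
  shows "sj_inner t a b c (p + q) r = sj_inner t a b c p r + sj_inner t a b c q r"
  using set_integral_add(2)[OF sj_integrable[OF assms, of "p * r" c] sj_integrable[OF assms, of "q * r" c]]
  by (simp add: sj_inner_def algebra_simps)

lemma sj_inner_smult_left: "sj_inner t a b c (smult s p) r = s * sj_inner t a b c p r"
  unfolding sj_inner_def by (simp add: mult.assoc flip: set_integral_mult_right)

lemma sj_inner_pos:
  assumes "t > 1" "a > -1" "b > -1" "p \<noteq> 0"
  shows "sj_inner t a b c p p > 0"
proof -
  let ?f = "\<lambda>x. poly p x * poly p x * (x powr a * (1 - x) powr b * (t - x) powr c)"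
  have int: "set_integrable lborel {0..1} ?f"
    using sj_integrable[OF assms(1-3), of "p * p" c] by simp
  have nonneg: "AE x in lborel. 0 \<le> indicator {0..1} x *\<^sub>R ?f x"
    by (auto intro!: AE_I2 simp: indicator_def)
  have "sj_inner t a b c p p \<ge> 0"
    unfolding sj_inner_def set_lebesgue_integral_def by (rule integral_nonneg_AE[OF nonneg])
  moreover have "sj_inner t a b c p p \<noteq> 0"
  proof
    assume "sj_inner t a b c p p = 0"
    then have "AE x in lborel. indicator {0..1} x *\<^sub>R ?f x = 0"
      using integral_nonneg_eq_0_iff_AE[OF int[unfolded set_integrable_def] nonneg]
      by (simp add: sj_inner_def set_lebesgue_integral_def)
    moreover have "AE x in lborel. x \<notin> {x. poly p x = 0}"
      by (rule AE_not_in) (auto intro!: finite_imp_null_set_lborel poly_roots_finite assms)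
    ultimately have "AE x in lborel. x \<notin> {0<..<1::real}"
      by eventually_elim (use assms in \<open>auto simp: indicator_def\<close>)
    then have "{0<..<1::real} \<in> null_sets lborel"
      by (subst AE_iff_null_sets) auto
    then have "emeasure lborel {0<..<1::real} = 0"
      by (rule null_setsD1)
    then show False by (subst (asm) emeasure_lborel_Ioo) auto
  qed
  ultimately show ?thesis by simp
qed

lemma sj_orthogonal_exists:
  assumes "t > 1" "a > -1" "b > -1"
  shows "\<exists>P. sj_orthogonal t a b c P"
proof -
  let ?B = "sj_inner t a b c"
  have sum_left: "?B (sum f A) r = (\<Sum>x\<in>A. ?B (f x) r)" if "finite A" for f :: "nat \<Rightarrow> real poly" and A r
    using that
  proof (induction A rule: finite_induct)
    case empty
    show ?case using sj_inner_smult_left[of t a b c 0 0 r] by simp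
  qed (simp add: sj_inner_add_left assms)
  have "\<exists>P. \<forall>k. degree (P k :: real poly) = k \<and> (\<forall>j<k. ?B (P k) (P j) = 0) \<and>
          (k = 0 \<longrightarrow> P k = 1) \<and> ?B (P k) (P k) = ?B 1 1"
  proof (rule dependent_wellorder_choice)
    fix k :: nat and f :: "nat \<Rightarrow> real poly"
    assume IH: "\<And>y. y < k \<Longrightarrow> degree (f y) = y \<and> (\<forall>j<y. ?B (f y) (f j) = 0) \<and>
          (y = 0 \<longrightarrow> f y = 1) \<and> ?B (f y) (f y) = ?B 1 1"
    show "\<exists>r. degree r = k \<and> (\<forall>j<k. ?B r (f j) = 0) \<and> (k = 0 \<longrightarrow> r = 1) \<and> ?B r r = ?B 1 1"
    proof (cases "k = 0")
      case False
      have one: "?B 1 1 > 0" by (rule sj_inner_pos) (use assms in auto)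
      define g where "g = (\<Sum>j<k. smult (- ?B (monom 1 k) (f j) / ?B 1 1) (f j))"
      define r where "r = monom 1 k + g"
      have "degree g < k"
        unfolding g_def using False IH
        by (intro degree_sum_less) (auto intro: le_less_trans[OF degree_smult_le])
      then have deg: "degree r = k"
        unfolding r_def by (subst degree_add_eq_left) (auto simp: degree_monom_eq)
      then have rnz: "r \<noteq> 0" using False by auto
      have orth: "?B r (f i) = 0" if "i < k" for i
      proof -
        have *: "?B (f j) (f i) = (if j = i then ?B 1 1 else 0)" if "j < k" for j
          using IH[OF that] IH[OF \<open>i < k\<close>] sj_inner_commute[of t a b c "f j" "f i"]
          by (cases j i rule: linorder_cases) auto
        have "?B r (f i) = ?B (monom 1 k) (f i) + (\<Sum>j<k. (- ?B (monom 1 k) (f j) / ?B 1 1) * ?B (f j) (f i))"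
          unfolding r_def g_def
          by (simp only: sj_inner_add_left[OF assms] sum_left[OF finite_lessThan] sj_inner_smult_left)
        also have "(\<Sum>j<k. (- ?B (monom 1 k) (f j) / ?B 1 1) * ?B (f j) (f i))
           = (\<Sum>j<k. if j = i then - ?B (monom 1 k) (f i) else 0)"
          by (rule sum.cong) (use one in \<open>auto simp: *\<close>)
        also have "\<dots> = - ?B (monom 1 k) (f i)" using that by simp
        finally show ?thesis by simp
      qed
      have rpos: "?B r r > 0" by (rule sj_inner_pos) (use assms rnz in auto)
      define s where "s = sqrt (?B 1 1 / ?B r r)"
      have s: "s > 0" "s * s * ?B r r = ?B 1 1"
        using one rpos by (auto simp: s_def)
      have "?B (smult s r) (smult s r) = s * s * ?B r r"
        by (simp add: sj_inner_smult_left sj_inner_commute[of t a b c r "smult s r"])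
      then show ?thesis
        using s deg orth False by (intro exI[of _ "smult s r"]) (auto simp: sj_inner_smult_left)
    qed (auto intro!: exI[of _ 1])
  qed auto
  then obtain P where P: "\<And>k. degree (P k) = k" "\<And>k j. j < k \<Longrightarrow> ?B (P k) (P j) = 0"
    "P 0 = 1" "\<And>k. ?B (P k) (P k) = ?B 1 1" by metis
  have "?B (P j) (P k) = 0" if "j \<noteq> k" for j k
    using that P(2)[of j k] P(2)[of k j] sj_inner_commute[of t a b c "P j" "P k"]
    by (cases j k rule: linorder_cases) auto
  with P show ?thesis unfolding sj_orthogonal_def by blast
qed

lemma semiclassical_jacobi_exists: "\<exists>P. semiclassical_jacobi P"
proof -
  have "\<forall>t a b c. \<exists>Q. t > 1 \<and> a > -1 \<and> b > -1 \<longrightarrow> sj_orthogonal t a b c Q"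
    using sj_orthogonal_exists by blast
  then obtain F where
    F: "\<And>t a b c. t > 1 \<and> a > -1 \<and> b > -1 \<longrightarrow> sj_orthogonal t a b c (F t a b c)"
    by metis
  show ?thesis
    unfolding semiclassical_jacobi_def
    by (rule exI[of _ "\<lambda>t a b c k. if b = -1 then if k = 0 then 1 else [:1, -1:] * F t a 1 c (k - 1)
          else F t a b c k"]) (use F in auto)
qed



section \<open>Arc polynomials\<close>

definition arc_p ::
  "(real \<Rightarrow> real \<Rightarrow> real \<Rightarrow> real \<Rightarrow> nat \<Rightarrow> real poly) \<Rightarrow> real \<Rightarrow> real \<Rightarrow> nat \<Rightarrow> real \<Rightarrow> real" where
  "arc_p P b h k x = poly (P (2 / (1 - h)) (-1/2) b (-1/2) k) ((cos x - 1) / (h - 1))"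

text \<open>Only used for \<open>k \<ge> 1\<close>.\<close>

definition arc_q ::
  "(real \<Rightarrow> real \<Rightarrow> real \<Rightarrow> real \<Rightarrow> nat \<Rightarrow> real poly) \<Rightarrow> real \<Rightarrow> real \<Rightarrow> nat \<Rightarrow> real \<Rightarrow> real" where
  "arc_q P b h k x = sin x * poly (P (2 / (1 - h)) (1/2) b (1/2) (k - 1)) ((cos x - 1) / (h - 1))"


section \<open>Piecewise bases on a periodic grid\<close>

text \<open>Grid points are \<open>\<theta> 1, \<dots>, \<theta> (n + 1)\<close> and elements are numbered \<open>1, \<dots>, n\<close>; the other
  values of \<open>\<theta>\<close> are irrelevant.\<close>

definition grid :: "nat \<Rightarrow> (nat \<Rightarrow> real) \<Rightarrow> bool" where
  "grid n \<theta> \<longleftrightarrow> \<theta> 1 = -pi \<and> \<theta> (n + 1) = pi \<and> strict_mono_on {1..n + 1} \<theta>"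

definition elem :: "(nat \<Rightarrow> real) \<Rightarrow> nat \<Rightarrow> real set" where
  "elem \<theta> i = {\<theta> i..\<theta> (i + 1)}"

definition half_length :: "(nat \<Rightarrow> real) \<Rightarrow> nat \<Rightarrow> real" where
  "half_length \<theta> i = (\<theta> (i + 1) - \<theta> i) / 2"

definition elem_shift :: "(nat \<Rightarrow> real) \<Rightarrow> nat \<Rightarrow> real \<Rightarrow> real" where
  "elem_shift \<theta> i x = x - (\<theta> i + \<theta> (i + 1)) / 2"

definition elem_prev :: "nat \<Rightarrow> nat \<Rightarrow> nat" where
  "elem_prev n i = (if i = 1 then n else i - 1)"

definition pw_q ::
  "(real \<Rightarrow> real \<Rightarrow> real \<Rightarrow> real \<Rightarrow> nat \<Rightarrow> real poly) \<Rightarrow> (nat \<Rightarrow> real) \<Rightarrow> real \<Rightarrow> nat \<Rightarrow> nat \<Rightarrow> real \<Rightarrow> real" where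
  "pw_q P \<theta> b m i x =
     (if x \<in> elem \<theta> i then arc_q P b (cos (half_length \<theta> i)) m (elem_shift \<theta> i x) else 0)"

definition pw_p ::
  "(real \<Rightarrow> real \<Rightarrow> real \<Rightarrow> real \<Rightarrow> nat \<Rightarrow> real poly) \<Rightarrow> (nat \<Rightarrow> real) \<Rightarrow> real \<Rightarrow> nat \<Rightarrow> nat \<Rightarrow> real \<Rightarrow> real" where
  "pw_p P \<theta> b m i x =
     (if x \<in> elem \<theta> i then arc_p P b (cos (half_length \<theta> i)) m (elem_shift \<theta> i x) else 0)"

text \<open>The two nonzero branches agree at a shared grid point, where both are \<open>1\<close> (or, for
  \<open>n = 2\<close>, both \<open>0\<close> at the other grid point), so the order of the tests is immaterial.\<close>

definition hat :: "nat \<Rightarrow> (nat \<Rightarrow> real) \<Rightarrow> nat \<Rightarrow> real \<Rightarrow> real" where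
  "hat n \<theta> i x =
     (let i' = elem_prev n i in
      if x \<in> elem \<theta> i' then (1 + sin (elem_shift \<theta> i' x) / sin (half_length \<theta> i')) / 2
      else if x \<in> elem \<theta> i then (1 - sin (elem_shift \<theta> i x) / sin (half_length \<theta> i)) / 2
      else 0)"

text \<open>A basis is a function of the block index (starting at \<open>0\<close>) and the position
  \<open>1, \<dots>, n\<close> within the block. In the notation \<open>P\<^sub>m\<^sub>1\<close> for \<open>pw_q\<close> and \<open>P\<^sub>m\<^sub>2\<close> for \<open>pw_p\<close> of degree
  \<open>m\<close>, the blocks are \<open>P\<^sub>0\<^sub>2, P\<^sub>1\<^sub>1, P\<^sub>1\<^sub>2, P\<^sub>2\<^sub>1, P\<^sub>2\<^sub>2, \<dots>\<close> for the parameter \<open>b = 0\<close>, and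
  \<open>H, P\<^sub>1\<^sub>2, P\<^sub>2\<^sub>1, P\<^sub>2\<^sub>2, P\<^sub>3\<^sub>1, \<dots>\<close> (without \<open>P\<^sub>1\<^sub>1\<close>) for \<open>b = -1\<close>.\<close>

definition basis_0 ::
  "(real \<Rightarrow> real \<Rightarrow> real \<Rightarrow> real \<Rightarrow> nat \<Rightarrow> real poly) \<Rightarrow> (nat \<Rightarrow> real) \<Rightarrow> nat \<Rightarrow> nat \<Rightarrow> real \<Rightarrow> real" where
  "basis_0 P \<theta> K =
     (if even K then pw_p P \<theta> 0 (K div 2) else pw_q P \<theta> 0 ((K + 1) div 2))"

definition basis_m1 ::
  "(real \<Rightarrow> real \<Rightarrow> real \<Rightarrow> real \<Rightarrow> nat \<Rightarrow> real poly) \<Rightarrow> nat \<Rightarrow> (nat \<Rightarrow> real) \<Rightarrow> nat \<Rightarrow> nat \<Rightarrow> real \<Rightarrow> real" where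
  "basis_m1 P n \<theta> K =
     (if K = 0 then hat n \<theta>
      else if odd K then pw_p P \<theta> (-1) ((K + 1) div 2)
      else pw_q P \<theta> (-1) (K div 2 + 1))"


section \<open>Infinite matrices of \<open>n \<times> n\<close> blocks\<close>

text \<open>\<open>A I J i j\<close> is the \<open>(i, j)\<close> entry, \<open>i, j \<in> {1..n}\<close>, of the block \<open>(I, J)\<close>; block indices
  start at \<open>0\<close>.\<close>

type_synonym block_matrix = "nat \<Rightarrow> nat \<Rightarrow> nat \<Rightarrow> nat \<Rightarrow> real"

definition cyclic_banded :: "nat \<Rightarrow> nat \<Rightarrow> nat \<Rightarrow> (nat \<Rightarrow> nat \<Rightarrow> real) \<Rightarrow> bool" where
  "cyclic_banded n l u A \<longleftrightarrow>
     (\<forall>i\<in>{1..n}. \<forall>j\<in>{1..n}.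
        (int i - int j > int l \<or> int j - int i > int u) \<and>
        \<not> (int n - int i + int j \<le> int u \<or> int n + int i - int j \<le> int l) \<longrightarrow> A i j = 0)"

definition CB3 :: "nat \<Rightarrow> nat \<Rightarrow> nat \<Rightarrow> nat \<Rightarrow> nat \<Rightarrow> block_matrix \<Rightarrow> bool" where
  "CB3 n l u lam mu A \<longleftrightarrow>
     (\<forall>I J. \<not> (- int l \<le> int J - int I \<and> int J - int I \<le> int u) \<longrightarrow>
        (\<forall>i\<in>{1..n}. \<forall>j\<in>{1..n}. A I J i j = 0)) \<and>
     cyclic_banded n (lam + mu) (lam + mu) (A 0 0) \<and>
     (\<forall>J\<ge>1. cyclic_banded n lam mu (A 0 J)) \<and>
     (\<forall>I\<ge>1. cyclic_banded n mu lam (A I 0)) \<and>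
     (\<forall>I\<ge>1. \<forall>J\<ge>1. \<forall>i\<in>{1..n}. \<forall>j\<in>{1..n}. i \<noteq> j \<longrightarrow> A I J i j = 0)"

text \<open>\<open>R\<close> is a matrix with \<open>G = F R\<close> on the interiors of the elements. Its columns have finite
  support, so that the product is a finite sum, and its entries are \<open>0\<close> outside the meaningful
  index range, so that it is determined as a function by its blocks.\<close>

definition connection_matrix ::
  "nat \<Rightarrow> (nat \<Rightarrow> real) \<Rightarrow> (nat \<Rightarrow> nat \<Rightarrow> real \<Rightarrow> real) \<Rightarrow> (nat \<Rightarrow> nat \<Rightarrow> real \<Rightarrow> real) \<Rightarrow> block_matrix \<Rightarrow> bool" where
  "connection_matrix n \<theta> F G R \<longleftrightarrow>
     (\<forall>I J i j. i \<notin> {1..n} \<or> j \<notin> {1..n} \<longrightarrow> R I J i j = 0) \<and>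
     (\<forall>J. \<forall>j\<in>{1..n}. finite {I. \<exists>i\<in>{1..n}. R I J i j \<noteq> 0}) \<and>
     (\<forall>J. \<forall>j\<in>{1..n}. \<forall>x \<in> (\<Union>e\<in>{1..n}. interior (elem \<theta> e)).
        G J j x = (\<Sum>I\<in>{I. \<exists>i\<in>{1..n}. R I J i j \<noteq> 0}. \<Sum>i=1..n. F I i x * R I J i j))"

definition gram_matrix ::
  "(nat \<Rightarrow> nat \<Rightarrow> real \<Rightarrow> real) \<Rightarrow> (nat \<Rightarrow> nat \<Rightarrow> real \<Rightarrow> real) \<Rightarrow> block_matrix" where
  "gram_matrix F G I J i j = (LBINT x:{-pi<..<pi}. F I i x * G J j x)"

end

theory Submission
  imports Defs
begin

text \<open>
  On an arc of half length \<open>\<phi>\<close> with \<open>h = cos \<phi>\<close>, every basis function has the form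
  \<open>A(\<sigma>) + sin \<theta> B(\<sigma>)\<close> with polynomials \<open>A\<close>, \<open>B\<close> in \<open>\<sigma> = (cos \<theta> - 1) / (h - 1)\<close>. The two summands
  are even and odd in \<open>\<theta>\<close>, and since \<open>sin\<^sup>2 \<theta> = (1 - h)\<^sup>2 \<sigma> (\<tau> - \<sigma>)\<close>, the substitution \<open>\<theta> \<mapsto> \<sigma>\<close> turns the
  \<open>L\<^sup>2\<close> inner product on the arc into the semiclassical Jacobi inner products of the \<open>A\<close> parts
  (exponents \<open>(-1/2, 0, -1/2)\<close>) and of the \<open>B\<close> parts (exponents \<open>(1/2, 0, 1/2)\<close>).
  A factor \<open>1 - \<sigma>\<close> raises the exponent \<open>b\<close> from \<open>0\<close> to \<open>1\<close>, so both the two-term connection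
  \<open>(1 - \<sigma>) Q\<^sub>m = \<alpha> P\<^sub>m + \<beta> P\<^sub>m\<^sub>+\<^sub>1\<close> (with \<open>P\<close> for \<open>b = 0\<close> and \<open>Q\<close> for \<open>b = 1\<close>) and the bandwidth of the
  mass matrix follow from orthogonality to polynomials of lower degree. The cyclic pattern of the blocks only reflects
  that the hat function \<open>\<phi>\<^sub>i\<close> lives on the elements \<open>E\<^sub>i\<^sub>-\<^sub>1\<close> and \<open>E\<^sub>i\<close>.
\<close>

section \<open>Polynomial factors that shift the exponents of the Jacobi weight\<close>

lemma sj_inner_0_left [simp]: "sj_inner t a b c 0 q = 0" and sj_inner_0_right [simp]: "sj_inner t a b c q 0 = 0"
  by (simp_all add: sj_inner_def)

lemma sj_inner_mult_one: "sj_inner t a b c p q = sj_inner t a b c (p * q) 1"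
  by (simp add: sj_inner_def)

text \<open>The integrands agree pointwise. At \<open>x = 1\<close> the value
  \<open>0 powr 0 = 0\<close> does no harm, since the factor \<open>1 - x\<close> vanishes
  there.\<close>

lemma sj_inner_shift_b: "sj_inner t a 0 c ([:1, -1:] * p) q = sj_inner t a 1 c p q"
  unfolding sj_inner_def
  by (intro set_lebesgue_integral_cong) (auto simp: algebra_simps)

text \<open>\<open>[:0, t, -1:]\<close> is \<open>x (t - x)\<close>, so the exponents of
  \<open>x\<close> and \<open>t - x\<close> both rise by one. For \<open>t = 2 / (1 - h)\<close>
  this factor is the squared sine on the arc up to a constant, hence it arises from products of two
  sine terms.\<close>

lemma sj_inner_shift_ac:
  assumes "t > 1"
  shows "sj_inner t (-1/2) b (-1/2) ([:0, t, -1:] * p) q = sj_inner t (1/2) b (1/2) p q"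
proof -
  have *: "y * (y powr (-1/2)) = y powr (1/2)" if "y \<ge> 0" for y :: real
    using that powr_add[of y 1 "-1/2"] by (cases "y = 0") auto
  have "poly ([:0, t, -1:] * p) x * poly q x * (x powr (-1/2) * (1 - x) powr b * (t - x) powr (-1/2))
      = poly p x * poly q x * (x powr (1/2) * (1 - x) powr b * (t - x) powr (1/2))"
    if "x \<in> {0..1}" for x
  proof -
    have "poly ([:0, t, -1:] * p) x * poly q x * (x powr (-1/2) * (1 - x) powr b * (t - x) powr (-1/2))
       = poly p x * poly q x * ((x * x powr (-1/2)) * (1 - x) powr b * ((t - x) * (t - x) powr (-1/2)))"
      by (simp add: algebra_simps)
    also have "x * x powr (-1/2) = x powr (1/2)" using that by (intro *) auto
    also have "(t - x) * (t - x) powr (-1/2) = (t - x) powr (1/2)" using that assms by (intro *) auto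
    finally show ?thesis by (simp only: mult_ac)
  qed
  then show ?thesis
    unfolding sj_inner_def by (intro set_lebesgue_integral_cong) auto
qed

section \<open>Inner products on a symmetric arc\<close>

lemma set_integral_symmetric:
  fixes f :: "real \<Rightarrow> real"
  assumes "r \<ge> 0" "continuous_on {-r..r} f"
  shows "(LBINT x:{-r..r}. f x) = (LBINT x:{0..r}. f x + f (- x))"
proof -
  have c: "continuous_on {-r..0} f" "continuous_on {0..r} f" "continuous_on {0..r} (\<lambda>x. f (- x))"
    using assms by (auto intro: continuous_on_subset intro!: continuous_on_compose2[OF assms(2)] continuous_intros)
  have "(LBINT x:{-r..r}. f x) = integral {-r..r} f"
    by (intro set_borel_integral_eq_integral borel_integrable_atLeastAtMost' assms)
  also have "\<dots> = integral {-r..0} f + integral {0..r} f"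
    by (rule Henstock_Kurzweil_Integration.integral_combine[symmetric]) (use assms in \<open>auto intro: integrable_continuous_real\<close>)
  also have "integral {-r..0} f = integral {0..r} (\<lambda>x. f (- x))"
    using Henstock_Kurzweil_Integration.integral_reflect_real[of r 0 "\<lambda>x. f (- x)"] by simp
  also have "\<dots> + integral {0..r} f = integral {0..r} (\<lambda>x. f x + f (- x))"
    using c by (subst Henstock_Kurzweil_Integration.integral_add) (auto intro: integrable_continuous_real)
  also have "\<dots> = (LBINT x:{0..r}. f x + f (- x))"
    by (intro set_borel_integral_eq_integral(2)[symmetric] borel_integrable_atLeastAtMost' continuous_intros c)
  finally show ?thesis .
qed

definition arc_fun :: "real \<Rightarrow> real poly \<Rightarrow> real poly \<Rightarrow> real \<Rightarrow> real" where
  "arc_fun h A B x = poly A ((cos x - 1) / (h - 1)) + sin x * poly B ((cos x - 1) / (h - 1))"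

lemma continuous_on_arc_fun [continuous_intros]: "h \<noteq> 1 \<Longrightarrow> continuous_on S (arc_fun h A B)"
  unfolding arc_fun_def by (auto intro!: continuous_intros)

lemma sin_squared_eq_arc:
  fixes h x :: real
  assumes "h \<noteq> 1"
  defines "s \<equiv> (cos x - 1) / (h - 1)"
  shows "(sin x)\<^sup>2 = (1 - h)\<^sup>2 * (s * (2 / (1 - h) - s))"
proof -
  have "(1 - h) * s = 1 - cos x" "(1 - h) * (2 / (1 - h)) = 2"
    using assms by (simp_all add: divide_simps) (simp add: algebra_simps)
  then have "(1 - h) * (2 / (1 - h) - s) = 1 + cos x"
    by (simp add: right_diff_distrib)
  then have "(1 - h)\<^sup>2 * (s * (2 / (1 - h) - s)) = (1 - cos x) * (1 + cos x)"
    using \<open>(1 - h) * s = 1 - cos x\<close> by (metis mult.assoc mult.left_commute power2_eq_square)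
  then show ?thesis
    by (simp only: sin_squared_eq) (simp add: power2_eq_square algebra_simps)
qed

text \<open>On the half arc \<open>g\<close> increases from 0 to 1, and its derivative
  \<open>sin x / (1 - h)\<close> is the square root of \<open>g x (t - g x)\<close>. This is the
  reciprocal of the Jacobi weight, so the substitution leaves an unweighted integral.\<close>

lemma half_arc_integral:
  assumes \<phi>: "0 < \<phi>" "\<phi> < pi"
  shows "(LBINT x:{0..\<phi>}. poly A ((cos x - 1) / (cos \<phi> - 1)))
       = sj_inner (2 / (1 - cos \<phi>)) (-1/2) 0 (-1/2) A 1"
proof -
  define h where "h = cos \<phi>"
  define t where "t = 2 / (1 - h)"
  define g where "g = (\<lambda>x. (cos x - 1) / (h - 1))"
  define f where "f = (\<lambda>x. poly A x * (x powr (-1/2) * (1 - x) powr 0 * (t - x) powr (-1/2)))"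
  have h: "-1 < h" "h < 1"
    using cos_monotone_0_pi[of 0 \<phi>] cos_monotone_0_pi[of \<phi> pi] \<phi> by (auto simp: h_def)
  then have t: "t > 1" by (simp add: t_def field_simps)
  have g0: "g 0 = 0" and g1: "g \<phi> = 1" using h by (auto simp: g_def h_def)
  have "(LBINT x. f x * indicator {g 0..g \<phi>} x)
      = (LBINT x. f (g x) * (sin x / (1 - h)) * indicator {0..\<phi>} x)"
  proof (rule integral_substitution(2))
    show "set_integrable lborel {g 0..g \<phi>} f"
      unfolding g0 g1 f_def by (rule sj_integrable) (use t in auto)
    show "(g has_real_derivative sin x / (1 - h)) (at x)" for x
      unfolding g_def using h by (auto intro!: derivative_eq_intros simp: divide_simps) (simp add: algebra_simps)
    show "continuous_on {0..\<phi>} (\<lambda>x. sin x / (1 - h))"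
      using h by (auto intro!: continuous_intros)
    show "0 \<le> sin x / (1 - h)" if "x \<in> {0..\<phi>}" for x
      using that \<phi> h by (auto intro!: sin_ge_zero divide_nonneg_nonneg)
  qed (use \<phi> in auto)
  also have "(LBINT x. f x * indicator {g 0..g \<phi>} x) = sj_inner t (-1/2) 0 (-1/2) A 1"
    unfolding g0 g1 sj_inner_def f_def set_lebesgue_integral_def by (simp add: mult_ac)
  also have "(LBINT x. f (g x) * (sin x / (1 - h)) * indicator {0..\<phi>} x)
      = (LBINT x. indicator {0..\<phi>} x * poly A (g x))"
  \<comment> \<open>The two integrands may differ at the end points: there
    \<open>0 powr (-1/2) = 0\<close> and \<open>0 powr 0 = 0\<close> make \<open>f (g x)\<close>
    vanish.\<close>
  proof (rule integral_discrete_difference[where X = "{0, \<phi>}"])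
    fix x :: real assume x: "x \<notin> {0, \<phi>}"
    show "f (g x) * (sin x / (1 - h)) * indicator {0..\<phi>} x = indicator {0..\<phi>} x * poly A (g x)"
    proof (cases "x \<in> {0<..<\<phi>}")
      case True
      then have s: "sin x > 0" using \<phi> by (auto intro: sin_gt_zero)
      have c: "h < cos x" "cos x < 1"
        using cos_monotone_0_pi[of 0 x] cos_monotone_0_pi[of x \<phi>] True \<phi> by (auto simp: h_def)
      have "g x > 0" "g x < 1"
        using c h by (auto simp: g_def field_simps)
      with t have *: "g x > 0" "g x < 1" "t - g x > 0" by auto
      have "(sin x)\<^sup>2 = (1 - h)\<^sup>2 * (g x * (t - g x))"
        using h unfolding g_def t_def by (intro sin_squared_eq_arc) auto
      then have "sin x = sqrt ((1 - h)\<^sup>2 * (g x * (t - g x)))"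
        using s by (metis abs_of_pos real_sqrt_abs)
      then have "sin x / (1 - h) = (g x) powr (1/2) * (t - g x) powr (1/2)"
        using h * by (simp add: real_sqrt_mult powr_half_sqrt)
      then have "(g x) powr (-1/2) * (t - g x) powr (-1/2) * (sin x / (1 - h))
          = (g x) powr (-1/2) * (g x) powr (1/2) * ((t - g x) powr (-1/2) * (t - g x) powr (1/2))"
        by (simp only: mult_ac)
      also have "\<dots> = 1"
        using * by (simp flip: powr_add)
      finally have one: "(g x) powr (-1/2) * (t - g x) powr (-1/2) * (sin x / (1 - h)) = 1" .
      have "f (g x) * (sin x / (1 - h))
          = poly A (g x) * (1 - g x) powr 0 * ((g x) powr (-1/2) * (t - g x) powr (-1/2) * (sin x / (1 - h)))"
        by (simp only: f_def mult_ac)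
      also have "\<dots> = poly A (g x)"
        unfolding one using * by simp
      finally have "f (g x) * (sin x / (1 - h)) = poly A (g x)" .
      then show ?thesis using True by simp
    qed (use x in \<open>auto simp: indicator_def\<close>)
  qed auto
  finally show ?thesis
    by (simp add: set_lebesgue_integral_def g_def t_def h_def)
qed

lemma arc_fun_product_integral:
  assumes \<phi>: "0 < \<phi>" "\<phi> < pi" and h: "h = cos \<phi>"
  shows "(LBINT x:{-\<phi>..\<phi>}. arc_fun h A B x * arc_fun h C D x)
       = 2 * sj_inner (2 / (1 - h)) (-1/2) 0 (-1/2) A C
       + 2 * (1 - h)\<^sup>2 * sj_inner (2 / (1 - h)) (1/2) 0 (1/2) B D"
proof -
  define t where "t = 2 / (1 - h)"
  have h1: "-1 < h" "h < 1"
    using cos_monotone_0_pi[of 0 \<phi>] cos_monotone_0_pi[of \<phi> pi] \<phi> by (auto simp: h)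
  then have t: "t > 1" by (simp add: t_def field_simps)
  \<comment> \<open>Adding the values at \<open>x\<close> and \<open>-x\<close> cancels the mixed
    terms, which are odd. What remains is twice the even part of the product, and in it the squared
    sine is a polynomial in \<open>s\<close>.\<close>
  define E where "E = smult 2 (A * C) + smult (2 * (1 - h)\<^sup>2) ([:0, t, -1:] * (B * D))"
  have "(LBINT x:{-\<phi>..\<phi>}. arc_fun h A B x * arc_fun h C D x)
      = (LBINT x:{0..\<phi>}. arc_fun h A B x * arc_fun h C D x + arc_fun h A B (-x) * arc_fun h C D (-x))"
    using \<phi> h1 by (intro set_integral_symmetric) (auto intro!: continuous_intros)
  also have "\<dots> = (LBINT x:{0..\<phi>}. poly E ((cos x - 1) / (h - 1)))"
  proof (intro set_lebesgue_integral_cong ballI allI impI)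
    fix x
    define s where "s = (cos x - 1) / (h - 1)"
    have s2: "(sin x)\<^sup>2 = (1 - h)\<^sup>2 * (s * (t - s))"
      using h1 unfolding s_def t_def by (intro sin_squared_eq_arc) auto
    have "arc_fun h A B x * arc_fun h C D x + arc_fun h A B (-x) * arc_fun h C D (-x)
       = 2 * (poly A s * poly C s) + 2 * (sin x)\<^sup>2 * (poly B s * poly D s)"
      by (simp add: arc_fun_def algebra_simps power2_eq_square flip: s_def)
    also have "\<dots> = poly E s"
      unfolding s2 E_def by (simp add: algebra_simps)
    finally show "arc_fun h A B x * arc_fun h C D x + arc_fun h A B (-x) * arc_fun h C D (-x) = poly E s" .
  qed simp
  also have "\<dots> = sj_inner t (-1/2) 0 (-1/2) E 1"
    using half_arc_integral[OF \<phi>, of E] by (simp add: t_def h)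
  also have "\<dots> = 2 * sj_inner t (-1/2) 0 (-1/2) (A * C) 1
      + 2 * (1 - h)\<^sup>2 * sj_inner t (-1/2) 0 (-1/2) ([:0, t, -1:] * (B * D)) 1"
    unfolding E_def using t by (simp only: sj_inner_add_left sj_inner_smult_left)
  also have "sj_inner t (-1/2) 0 (-1/2) (A * C) 1 = sj_inner t (-1/2) 0 (-1/2) A C"
    by (rule sj_inner_mult_one[symmetric])
  also have "sj_inner t (-1/2) 0 (-1/2) ([:0, t, -1:] * (B * D)) 1 = sj_inner t (1/2) 0 (1/2) B D"
    unfolding sj_inner_shift_ac[OF t] by (rule sj_inner_mult_one[symmetric])
  finally show ?thesis unfolding t_def .
qed

section \<open>Expansions in orthogonal polynomials\<close>

lemma sj_inner_sum_left:
  assumes "t > 1" "a > -1" "b > -1"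
  shows "sj_inner t a b c (\<Sum>x\<in>S. f x) q = (\<Sum>x\<in>S. sj_inner t a b c (f x) q)"
proof (cases "finite S")
  case True
  then show ?thesis
    by (induction S rule: finite_induct) (simp_all add: sj_inner_add_left assms)
qed simp

text \<open>Subtracting the multiple of \<open>P N\<close> that matches the top coefficient lowers
  the degree bound. \<open>P 0 \<noteq> 0\<close> is a separate hypothesis because the zero
  polynomial also has degree 0.\<close>

lemma poly_sum_of_degrees:
  fixes P :: "nat \<Rightarrow> 'a::field poly"
  assumes "\<And>k. degree (P k) = k" "P 0 \<noteq> 0" "degree p \<le> N"
  shows "\<exists>c. p = (\<Sum>k\<le>N. smult (c k) (P k))"
  using assms(3)
proof (induction N arbitrary: p)
  case 0
  then obtain u v where "p = [:u:]" "P 0 = [:v:]"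
    by (metis assms(1) degree_eq_zeroE le_zero_eq)
  then show ?case using assms(2) by (intro exI[of _ "\<lambda>_. u / v"]) auto
next
  case (Suc N)
  define s where "s = coeff p (Suc N) / lead_coeff (P (Suc N))"
  have "lead_coeff (P (Suc N)) \<noteq> 0"
    using assms(1)[of "Suc N"] by (metis degree_0 leading_coeff_0_iff nat.distinct(1))
  then have "coeff (p - smult s (P (Suc N))) (Suc N) = 0"
    by (simp add: s_def assms(1))
  moreover have "degree (p - smult s (P (Suc N))) \<le> Suc N"
    using Suc.prems by (auto intro!: degree_diff_le order.trans[OF degree_smult_le] simp: assms(1))
  ultimately have "degree (p - smult s (P (Suc N))) \<le> N"
    by (metis coeff_0 degree_0 le_SucE le_zero_eq leading_coeff_0_iff nat.distinct(1) zero_le)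
  from Suc.IH[OF this] obtain c where c: "p - smult s (P (Suc N)) = (\<Sum>k\<le>N. smult (c k) (P k))" ..
  have "p = (\<Sum>k\<le>Suc N. smult ((c(Suc N := s)) k) (P k))"
    using c by (simp add: algebra_simps)
  then show ?case by blast
qed

lemma sj_orthogonal_norm_pos:
  assumes "t > 1" "a > -1" "b > -1" "sj_orthogonal t a b c P"
  shows "sj_inner t a b c (P k) (P k) > 0"
  using assms sj_inner_pos[OF assms(1-3), of 1 c] unfolding sj_orthogonal_def by simp

lemma sj_orthogonal_lower_degree:
  assumes "t > 1" "a > -1" "b > -1" "sj_orthogonal t a b c P" "degree p < m"
  shows "sj_inner t a b c p (P m) = 0"
proof -
  have "\<exists>d. p = (\<Sum>k\<le>m-1. smult (d k) (P k))"
    using assms by (intro poly_sum_of_degrees) (auto simp: sj_orthogonal_def)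
  then obtain d where d: "p = (\<Sum>k\<le>m-1. smult (d k) (P k))" ..
  show ?thesis
    unfolding d using assms
    by (auto simp: sj_inner_sum_left sj_inner_smult_left sj_orthogonal_def intro!: sum.neutral)
qed

text \<open>For \<open>k < m\<close> the coefficient of \<open>P k\<close> is proportional to the
  \<open>b = 0\<close> product of \<open>(1 - x) Q m\<close> with \<open>P k\<close>. This is the
  \<open>b = 1\<close> product of \<open>Q m\<close> with a polynomial of lower degree, hence zero,
  and only the degrees \<open>m\<close> and \<open>m + 1\<close> survive.\<close>

lemma sj_raise_b_two_term:
  assumes "t > 1" "a > -1" "sj_orthogonal t a 0 c P" "sj_orthogonal t a 1 c Q"
  shows "\<exists>\<alpha> \<beta>. [:1, -1:] * Q m = smult \<alpha> (P m) + smult \<beta> (P (Suc m))"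
proof -
  have P: "\<And>k. degree (P k) = k" "P 0 = 1" "\<And>j k. j \<noteq> k \<Longrightarrow> sj_inner t a 0 c (P j) (P k) = 0"
   and Q: "degree (Q m) = m"
    using assms by (auto simp: sj_orthogonal_def)
  have "degree ([:1, -1:] * Q m) \<le> Suc m"
    using degree_mult_le[of "[:1, -1:]" "Q m"] Q by auto
  then obtain d where d: "[:1, -1:] * Q m = (\<Sum>k\<le>Suc m. smult (d k) (P k))"
    using poly_sum_of_degrees[of P "[:1, -1:] * Q m" "Suc m"] P by auto
  have "d k = 0" if "k < m" for k
  proof -
    have "sj_inner t a 0 c ([:1, -1:] * Q m) (P k) = 0"
      using sj_orthogonal_lower_degree[OF assms(1,2) _ assms(4), of "P k" m] that P(1)[of k]
      by (simp add: sj_inner_shift_b sj_inner_commute[of _ _ _ _ "Q m"] del: mult_pCons_left)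
    also have "sj_inner t a 0 c ([:1, -1:] * Q m) (P k) = (\<Sum>j\<le>Suc m. d j * sj_inner t a 0 c (P j) (P k))"
      unfolding d using assms by (simp only: sj_inner_sum_left sj_inner_smult_left)
    also have "\<dots> = (\<Sum>j\<le>Suc m. if j = k then d k * sj_inner t a 0 c (P k) (P k) else 0)"
      by (intro sum.cong) (auto simp: P)
    also have "\<dots> = d k * sj_inner t a 0 c (P k) (P k)" using that by simp
    finally show ?thesis
      using sj_orthogonal_norm_pos[OF assms(1,2) _ assms(3), of k] by auto
  qed
  then have "(\<Sum>k\<le>Suc m. smult (d k) (P k)) = (\<Sum>k\<in>{m, Suc m}. smult (d k) (P k))"
    by (intro sum.mono_neutral_right) (auto simp: not_le)
  then show ?thesis using d by auto
qed

section \<open>Vanishing on an arc, and integrals over a grid\<close>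

text \<open>The integral of the square is a sum of a squared norm of \<open>A\<close> and a positive
  multiple of a squared norm of \<open>B\<close>, so both norms are zero. This makes the pair
  \<open>A\<close>, \<open>B\<close> of a function on the arc unique.\<close>

lemma arc_fun_eq_0:
  assumes \<phi>: "0 < \<phi>" "\<phi> < pi" and h: "h = cos \<phi>"
    and zero: "\<And>x. -\<phi> < x \<Longrightarrow> x < \<phi> \<Longrightarrow> arc_fun h A B x = 0"
  shows "A = 0" "B = 0"
proof -
  have h1: "-1 < h" "h < 1"
    using cos_monotone_0_pi[of 0 \<phi>] cos_monotone_0_pi[of \<phi> pi] \<phi> by (auto simp: h)
  then have t: "2 / (1 - h) > 1" by (simp add: field_simps)
  have nonneg: "sj_inner (2 / (1 - h)) a 0 c p p \<ge> 0" if "a > -1" for a c p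
    using sj_inner_pos[OF t that, of 0 p c] by (cases "p = 0") auto
  have "(LBINT x:{-\<phi>..\<phi>}. arc_fun h A B x * arc_fun h A B x) = (LBINT x:{-\<phi>..\<phi>}. 0 :: real)"
    unfolding set_lebesgue_integral_def
    by (rule integral_discrete_difference[where X = "{-\<phi>, \<phi>}"]) (auto simp: indicator_def zero)
  then have *: "sj_inner (2 / (1 - h)) (-1/2) 0 (-1/2) A A
      + (1 - h)\<^sup>2 * sj_inner (2 / (1 - h)) (1/2) 0 (1/2) B B = 0"
    by (simp add: arc_fun_product_integral[OF \<phi> h])
  have "(1 - h)\<^sup>2 * sj_inner (2 / (1 - h)) (1/2) 0 (1/2) B B \<ge> 0"
    by (intro mult_nonneg_nonneg nonneg) auto
  with * nonneg[of "-1/2" "-1/2" A]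
  have "sj_inner (2 / (1 - h)) (-1/2) 0 (-1/2) A A = 0"
    "(1 - h)\<^sup>2 * sj_inner (2 / (1 - h)) (1/2) 0 (1/2) B B = 0"
    by linarith+
  then have "sj_inner (2 / (1 - h)) (-1/2) 0 (-1/2) A A = 0" "sj_inner (2 / (1 - h)) (1/2) 0 (1/2) B B = 0"
    using h1 by auto
  then show "A = 0" "B = 0"
    using sj_inner_pos[OF t, of "-1/2" 0 A "-1/2"] sj_inner_pos[OF t, of "1/2" 0 B "1/2"] by auto
qed

text \<open>The finitely many grid points form a null set, so the values of \<open>f\<close> inside
  the elements determine the integral.\<close>

lemma set_integral_piecewise:
  fixes f :: "real \<Rightarrow> real" and n :: nat
  assumes mono: "strict_mono_on {1..n + 1} \<theta>"
    and cont: "\<And>e. e \<in> {1..n} \<Longrightarrow> continuous_on {\<theta> e..\<theta> (e + 1)} (g e)"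
    and eq: "\<And>e x. e \<in> {1..n} \<Longrightarrow> \<theta> e < x \<Longrightarrow> x < \<theta> (e + 1) \<Longrightarrow> f x = g e x"
  shows "(LBINT x:{\<theta> 1<..<\<theta> (n + 1)}. f x) = (\<Sum>e=1..n. LBINT x:{\<theta> e..\<theta> (e + 1)}. g e x)"
proof -
  have le: "\<theta> i \<le> \<theta> j" if "i \<ge> 1" "i \<le> j" "j \<le> n + 1" for i j
    using strict_mono_onD[OF mono, of i j] that by (cases i j rule: linorder_cases) auto
  have locate: "\<exists>e\<in>{1..m}. \<theta> e < x \<and> x < \<theta> (e + 1)"
    if "\<theta> 1 < x" "x < \<theta> (m + 1)" "x \<notin> \<theta> ` {1..m + 1}" for m x
    using that
  proof (induction m)
    case (Suc m)
    have "x \<noteq> \<theta> (m + 1)" "x \<notin> \<theta> ` {1..m + 1}" using Suc.prems(3) by auto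
    then consider "x < \<theta> (m + 1)" | "\<theta> (m + 1) < x" by linarith
    then show ?case
    proof cases
      case 1
      from Suc.IH[OF Suc.prems(1) this \<open>x \<notin> \<theta> ` {1..m + 1}\<close>]
      obtain e where "e \<in> {1..m}" "\<theta> e < x" "x < \<theta> (e + 1)" by blast
      then show ?thesis by (intro bexI[of _ e]) auto
    next
      case 2
      then show ?thesis using Suc.prems(2) by (intro bexI[of _ "Suc m"]) auto
    qed
  qed auto
  have "(LBINT x:{\<theta> 1<..<\<theta> (n + 1)}. f x)
      = (LBINT x. \<Sum>e=1..n. indicator {\<theta> e..\<theta> (e + 1)} x *\<^sub>R g e x)"
    unfolding set_lebesgue_integral_def
  proof (rule integral_discrete_difference[where X = "\<theta> ` {1..n + 1}"])
    fix x assume x: "x \<notin> \<theta> ` {1..n + 1}"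
    show "indicator {\<theta> 1<..<\<theta> (n + 1)} x *\<^sub>R f x = (\<Sum>e=1..n. indicator {\<theta> e..\<theta> (e + 1)} x *\<^sub>R g e x)"
    proof (cases "x \<in> {\<theta> 1<..<\<theta> (n + 1)}")
      case True
      then obtain e where e: "e \<in> {1..n}" "\<theta> e < x" "x < \<theta> (e + 1)"
        using locate[of x n] x by auto
      \<comment> \<open>Every other element ends at or before \<open>\<theta> e\<close> or begins at
        or after \<open>\<theta> (e + 1)\<close>, so one summand survives.\<close>
      have "x \<notin> {\<theta> e'..\<theta> (e' + 1)}" if "e' \<in> {1..n}" "e' \<noteq> e" for e'
        using le[of "e' + 1" e] le[of "e + 1" e'] that e by (cases "e' < e") auto
      then have "(\<Sum>e'=1..n. indicator {\<theta> e'..\<theta> (e' + 1)} x *\<^sub>R g e' x) = (\<Sum>e'=1..n. if e' = e then g e x else 0)"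
        using e by (intro sum.cong) (auto simp: indicator_def)
      then show ?thesis using True e by (simp add: eq)
    next
      case False
      then have "x < \<theta> 1 \<or> \<theta> (n + 1) < x"
        using x by (metis atLeastAtMost_iff greaterThanLessThan_iff imageI le_add2 le_refl linorder_less_linear)
      then have "x \<notin> {\<theta> e..\<theta> (e + 1)}" if "e \<in> {1..n}" for e
        using that le[of 1 e] le[of "e + 1" "n + 1"] by auto
      then show ?thesis using False by simp
    qed
  qed auto
  also have "\<dots> = (\<Sum>e=1..n. LBINT x:{\<theta> e..\<theta> (e + 1)}. g e x)"
    unfolding set_lebesgue_integral_def
    by (rule Bochner_Integration.integral_sum)
       (use borel_integrable_atLeastAtMost'[OF cont] in \<open>simp add: set_integrable_def\<close>)
  finally show ?thesis .
qed

lemma set_integral_shift: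
  fixes f :: "real \<Rightarrow> real"
  shows "(LBINT x:{a..b}. f (x - m)) = (LBINT x:{a - m..b - m}. f x)"
  unfolding set_lebesgue_integral_def
  by (subst lborel_integral_real_affine[of 1 _ m])
     (auto intro!: Bochner_Integration.integral_cong simp: indicator_def)

section \<open>The basis functions on a single element\<close>

locale arc_grid =
  fixes P :: "real \<Rightarrow> real \<Rightarrow> real \<Rightarrow> real \<Rightarrow> nat \<Rightarrow> real poly" and n :: nat and \<theta> :: "nat \<Rightarrow> real"
  assumes jacobi: "semiclassical_jacobi P" and n2: "n \<ge> 2" and grid: "grid n \<theta>"
begin

abbreviation h :: "nat \<Rightarrow> real" where "h e \<equiv> cos (half_length \<theta> e)"
abbreviation \<tau> :: "nat \<Rightarrow> real" where "\<tau> e \<equiv> 2 / (1 - h e)"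

lemma grid_less: "\<theta> i < \<theta> j" if "1 \<le> i" "i < j" "j \<le> n + 1"
  using grid that by (auto simp: grid_def strict_mono_on_def)

lemma grid_le: "\<theta> i \<le> \<theta> j" if "1 \<le> i" "i \<le> j" "j \<le> n + 1"
  using grid_less[of i j] that by (cases "i = j") auto

text \<open>With at least two elements none covers the whole circle. Half length \<open>pi\<close>
  would give \<open>h e = -1\<close> and \<open>\<tau> e = 1\<close>, outside the range of the
  Jacobi parameter.\<close>

lemma half_length_bounds:
  assumes "e \<in> {1..n}"
  shows "0 < half_length \<theta> e" "half_length \<theta> e < pi"
proof -
  have ends: "\<theta> 1 = -pi" "\<theta> (n + 1) = pi" using grid by (auto simp: grid_def)
  show "0 < half_length \<theta> e"
    using grid_less[of e "e + 1"] assms by (simp add: half_length_def)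
  show "half_length \<theta> e < pi"
  proof (cases "e = 1")
    case True
    then show ?thesis using grid_less[of 2 "n + 1"] n2 ends by (simp add: half_length_def numeral_2_eq_2)
  next
    case False
    then show ?thesis
      using grid_less[of 1 e] grid_le[of "e + 1" "n + 1"] assms ends by (simp add: half_length_def)
  qed
qed

lemma \<tau>_gt_1: "\<tau> e > 1" and h_less_1: "h e < 1" if "e \<in> {1..n}"
proof -
  have "-1 < h e" "h e < 1"
    using cos_monotone_0_pi[of 0 "half_length \<theta> e"] cos_monotone_0_pi[of "half_length \<theta> e" pi]
      half_length_bounds[OF that] by auto
  then show "\<tau> e > 1" "h e < 1" by (auto simp: field_simps)
qed

lemma orthogonal_P:
  "sj_orthogonal (\<tau> e) a b c (P (\<tau> e) a b c)" if "e \<in> {1..n}" "a > -1" "b > -1"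
  using jacobi \<tau>_gt_1[OF that(1)] that by (auto simp: semiclassical_jacobi_def)

lemma degree_P: "degree (P (\<tau> e) a b c k) = k" if "e \<in> {1..n}" "a > -1" "b > -1"
  using orthogonal_P[OF that] by (auto simp: sj_orthogonal_def)

lemma elem_unique:
  assumes "e \<in> {1..n}" "\<theta> e < x" "x < \<theta> (e + 1)" "i \<in> {1..n}"
  shows "x \<in> elem \<theta> i \<longleftrightarrow> i = e"
  using assms grid_le[of "i + 1" e] grid_le[of "e + 1" i]
  by (cases i e rule: linorder_cases) (auto simp: elem_def)

text \<open>The inequality rests on \<open>n2\<close>: a single element would be its own
  predecessor.\<close>

lemma elem_prev: "elem_prev n i \<in> {1..n}" "elem_prev n i \<noteq> i" if "i \<in> {1..n}"
  using that n2 by (auto simp: elem_prev_def)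

definition supported :: "nat \<Rightarrow> nat \<Rightarrow> nat \<Rightarrow> bool" where
  "supported K i e \<longleftrightarrow> e = i \<or> K = 0 \<and> e = elem_prev n i"

text \<open>On element \<open>e\<close>, \<open>even_part\<close> and \<open>odd_part\<close> are the polynomials \<open>A\<close>, \<open>B\<close> of the basis function
  number \<open>i\<close> in block \<open>K\<close>; for \<open>b = 0\<close> only the case \<open>i = e\<close> is nonzero, so \<open>i\<close> is omitted.\<close>

definition even_part_0 :: "nat \<Rightarrow> nat \<Rightarrow> real poly" where
  "even_part_0 K e = (if even K then P (\<tau> e) (-1/2) 0 (-1/2) (K div 2) else 0)"

definition odd_part_0 :: "nat \<Rightarrow> nat \<Rightarrow> real poly" where
  "odd_part_0 K e = (if even K then 0 else P (\<tau> e) (1/2) 0 (1/2) (K div 2))"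

text \<open>The convention for \<open>b = -1\<close> is already unfolded here: degree
  \<open>k\<close> becomes \<open>1 - x\<close> times degree \<open>k - 1\<close> for
  \<open>b = 1\<close>. Thus block \<open>2m + 1\<close> has this even part with index
  \<open>m\<close>, and block \<open>2m + 2\<close> has the odd part below with index
  \<open>m\<close>. The constants for \<open>K = 0\<close> are the two terms of the hat
  function.\<close>

definition even_part_m1 :: "nat \<Rightarrow> nat \<Rightarrow> nat \<Rightarrow> real poly" where
  "even_part_m1 K i e =
     (if K = 0 then if supported K i e then [:1/2:] else 0
      else if e = i \<and> odd K then [:1, -1:] * P (\<tau> e) (-1/2) 1 (-1/2) (K div 2) else 0)"

definition odd_part_m1 :: "nat \<Rightarrow> nat \<Rightarrow> nat \<Rightarrow> real poly" where
  "odd_part_m1 K i e =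
     (if K = 0 then
        [:if e = i then -1 / (2 * sin (half_length \<theta> e))
          else if e = elem_prev n i then 1 / (2 * sin (half_length \<theta> e)) else 0:]
      else if e = i \<and> even K then [:1, -1:] * P (\<tau> e) (1/2) 1 (1/2) (K div 2 - 1) else 0)"

lemma basis_0_on_elem:
  assumes "e \<in> {1..n}" "\<theta> e < x" "x < \<theta> (e + 1)" "i \<in> {1..n}"
  shows "basis_0 P \<theta> K i x = (if i = e then arc_fun (h e) (even_part_0 K e) (odd_part_0 K e) (elem_shift \<theta> e x) else 0)"
proof (cases "i = e")
  case True
  have "(K + 1) div 2 - 1 = K div 2" if "odd K" using that by presburger
  then show ?thesis
    using True elem_unique[OF assms]
    by (auto simp: basis_0_def pw_p_def pw_q_def arc_p_def arc_q_def even_part_0_def odd_part_0_def arc_fun_def)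
next
  case False
  then show ?thesis using elem_unique[OF assms] by (auto simp: basis_0_def pw_p_def pw_q_def)
qed

lemma basis_m1_on_elem:
  assumes "e \<in> {1..n}" "\<theta> e < x" "x < \<theta> (e + 1)" "i \<in> {1..n}"
  shows "basis_m1 P n \<theta> K i x = arc_fun (h e) (even_part_m1 K i e) (odd_part_m1 K i e) (elem_shift \<theta> e x)"
proof (cases "K = 0")
  case True
  then show ?thesis
    using elem_unique[OF assms] elem_unique[OF assms(1-3) elem_prev(1)[OF assms(4)]] elem_prev(2)[OF assms(4)]
    by (auto simp: basis_m1_def hat_def Let_def arc_fun_def even_part_m1_def odd_part_m1_def supported_def field_simps)
next
  case False
  have lower: "P (\<tau> e) a (-1) c k = [:1, -1:] * P (\<tau> e) a 1 c (k - 1)" if "a > -1" "k \<ge> 1" for a c k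
    using jacobi \<tau>_gt_1[OF assms(1)] that unfolding semiclassical_jacobi_def by blast
  show ?thesis
  proof (cases "i = e")
    case True
    have "(K + 1) div 2 - 1 = K div 2" if "odd K" using that by presburger
    \<comment> \<open>The factor \<open>1 - x\<close> is available only from index 1 on. The sine
      blocks satisfy this because the basis starts them at degree 2, and \<open>arc_q\<close> lowers
      the index by one.\<close>
    moreover have "K div 2 \<ge> 1" if "even K" using that False by presburger
    moreover have "(K + 1) div 2 \<ge> 1" using False by auto
    ultimately show ?thesis
      using True False elem_unique[OF assms]
      by (auto simp: basis_m1_def pw_p_def pw_q_def arc_p_def arc_q_def even_part_m1_def odd_part_m1_def arc_fun_def lower
               simp del: mult_pCons_left)
  next
    case F: False
    then show ?thesis using False elem_unique[OF assms]
      by (auto simp: basis_m1_def pw_p_def pw_q_def even_part_m1_def odd_part_m1_def arc_fun_def)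
  qed
qed

lemma not_supported: "even_part_m1 K i e = 0" "odd_part_m1 K i e = 0" if "\<not> supported K i e"
  using that by (auto simp: even_part_m1_def odd_part_m1_def supported_def)

text \<open>These bounds, with the constant parts of the hat block included, determine the bandwidth
  of the mass matrix.\<close>

lemma degree_even_part_m1: "degree (even_part_m1 K i e) \<le> (K + 1) div 2" if "e \<in> {1..n}"
  using degree_mult_le[of "[:1, -1:]" "P (\<tau> e) (-1/2) 1 (-1/2) (K div 2)"] degree_P[OF that, of "-1/2" 1]
  by (auto simp: even_part_m1_def elim!: oddE simp del: mult_pCons_left)

lemma degree_odd_part_m1: "degree (odd_part_m1 K i e) \<le> K div 2" if "e \<in> {1..n}"
  using degree_mult_le[of "[:1, -1:]" "P (\<tau> e) (1/2) 1 (1/2) (K div 2 - 1)"] degree_P[OF that, of "1/2" 1]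
  by (auto simp: odd_part_m1_def elim!: evenE simp del: mult_pCons_left)

section \<open>The mass matrix\<close>

lemma gram_m1:
  assumes "i \<in> {1..n}" "j \<in> {1..n}"
  shows "gram_matrix (basis_m1 P n \<theta>) (basis_m1 P n \<theta>) I J i j
    = (\<Sum>e=1..n. 2 * sj_inner (\<tau> e) (-1/2) 0 (-1/2) (even_part_m1 I i e) (even_part_m1 J j e)
        + 2 * (1 - h e)\<^sup>2 * sj_inner (\<tau> e) (1/2) 0 (1/2) (odd_part_m1 I i e) (odd_part_m1 J j e))"
proof -
  define g where "g = (\<lambda>e x. arc_fun (h e) (even_part_m1 I i e) (odd_part_m1 I i e) x
                    * arc_fun (h e) (even_part_m1 J j e) (odd_part_m1 J j e) x)"
  have cont: "continuous_on S (g e)" if "e \<in> {1..n}" for e S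
    using h_less_1[OF that] unfolding g_def by (intro continuous_intros) auto
  have "gram_matrix (basis_m1 P n \<theta>) (basis_m1 P n \<theta>) I J i j
      = (LBINT x:{\<theta> 1<..<\<theta> (n + 1)}. basis_m1 P n \<theta> I i x * basis_m1 P n \<theta> J j x)"
    using grid by (simp add: gram_matrix_def grid_def)
  also have "\<dots> = (\<Sum>e=1..n. LBINT x:{\<theta> e..\<theta> (e + 1)}. g e (elem_shift \<theta> e x))"
  proof (rule set_integral_piecewise)
    show "strict_mono_on {1..n + 1} \<theta>" using grid by (simp add: grid_def)
    show "continuous_on {\<theta> e..\<theta> (e + 1)} (\<lambda>x. g e (elem_shift \<theta> e x))" if "e \<in> {1..n}" for e
      unfolding elem_shift_def by (intro continuous_on_compose2[OF cont[OF that, of UNIV]] continuous_intros) auto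
  qed (use assms in \<open>simp add: basis_m1_on_elem g_def\<close>)
  also have "\<dots> = (\<Sum>e=1..n. LBINT x:{-half_length \<theta> e..half_length \<theta> e}. g e x)"
  proof (intro sum.cong refl)
    fix e
    have "\<theta> e - (\<theta> e + \<theta> (e + 1)) / 2 = - half_length \<theta> e"
      "\<theta> (e + 1) - (\<theta> e + \<theta> (e + 1)) / 2 = half_length \<theta> e"
      by (simp_all add: half_length_def field_simps)
    then show "(LBINT x:{\<theta> e..\<theta> (e + 1)}. g e (elem_shift \<theta> e x))
        = (LBINT x:{-half_length \<theta> e..half_length \<theta> e}. g e x)"
      unfolding elem_shift_def set_integral_shift by (simp only:)
  qed
  also have "\<dots> = (\<Sum>e=1..n. 2 * sj_inner (\<tau> e) (-1/2) 0 (-1/2) (even_part_m1 I i e) (even_part_m1 J j e)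
        + 2 * (1 - h e)\<^sup>2 * sj_inner (\<tau> e) (1/2) 0 (1/2) (odd_part_m1 I i e) (odd_part_m1 J j e))"
    using half_length_bounds unfolding g_def by (intro sum.cong arc_fun_product_integral) auto
  finally show ?thesis .
qed

lemma gram_m1_commute:
  "gram_matrix (basis_m1 P n \<theta>) (basis_m1 P n \<theta>) I J i j = gram_matrix (basis_m1 P n \<theta>) (basis_m1 P n \<theta>) J I j i"
  by (simp add: gram_matrix_def mult.commute)

lemma gram_m1_not_supported:
  assumes "i \<in> {1..n}" "j \<in> {1..n}" "\<And>e. e \<in> {1..n} \<Longrightarrow> \<not> (supported I i e \<and> supported J j e)"
  shows "gram_matrix (basis_m1 P n \<theta>) (basis_m1 P n \<theta>) I J i j = 0"
  unfolding gram_m1[OF assms(1,2)] using assms(3) not_supported by (intro sum.neutral) fastforce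

text \<open>Since \<open>J > 0\<close>, the part with index \<open>J\<close> carries the factor
  \<open>1 - x\<close>. It turns the \<open>b = 0\<close> product into a \<open>b = 1\<close>
  product, in which the remaining orthogonal polynomial is tested against one of lower
  degree.\<close>

lemma gram_m1_banded_aux:
  assumes "i \<in> {1..n}" "j \<in> {1..n}" "J > I + 2"
  shows "gram_matrix (basis_m1 P n \<theta>) (basis_m1 P n \<theta>) I J i j = 0"
proof -
  have A: "sj_inner (\<tau> e) (-1/2) 0 (-1/2) (even_part_m1 I i e) (even_part_m1 J j e) = 0" if e: "e \<in> {1..n}" for e
  proof (cases "e = j \<and> odd J")
    case True
    have "sj_inner (\<tau> e) (-1/2) 0 (-1/2) (even_part_m1 J j e) (even_part_m1 I i e)
        = sj_inner (\<tau> e) (-1/2) 1 (-1/2) (P (\<tau> e) (-1/2) 1 (-1/2) (J div 2)) (even_part_m1 I i e)"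
      using True assms(3) by (auto simp: even_part_m1_def[of J] sj_inner_shift_b simp del: mult_pCons_left)
    also have "\<dots> = sj_inner (\<tau> e) (-1/2) 1 (-1/2) (even_part_m1 I i e) (P (\<tau> e) (-1/2) 1 (-1/2) (J div 2))"
      by (rule sj_inner_commute)
    also have "\<dots> = 0"
    proof (rule sj_orthogonal_lower_degree)
      \<comment> \<open>For odd \<open>I\<close> the choice \<open>J = I + 2\<close> would give
        equality, so distance two stays inside the band.\<close>
      have "(I + 1) div 2 < J div 2" using True assms(3) by presburger
      then show "degree (even_part_m1 I i e) < J div 2" using degree_even_part_m1[OF e, of I i] by simp
    qed (use \<tau>_gt_1[OF e] orthogonal_P[OF e] in auto)
    finally show ?thesis by (subst sj_inner_commute)
  qed (use assms(3) in \<open>auto simp: even_part_m1_def[of J]\<close>)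
  have B: "sj_inner (\<tau> e) (1/2) 0 (1/2) (odd_part_m1 I i e) (odd_part_m1 J j e) = 0" if e: "e \<in> {1..n}" for e
  proof (cases "e = j \<and> even J")
    case True
    have "sj_inner (\<tau> e) (1/2) 0 (1/2) (odd_part_m1 J j e) (odd_part_m1 I i e)
        = sj_inner (\<tau> e) (1/2) 1 (1/2) (P (\<tau> e) (1/2) 1 (1/2) (J div 2 - 1)) (odd_part_m1 I i e)"
      using True assms(3) by (auto simp: odd_part_m1_def[of J] sj_inner_shift_b simp del: mult_pCons_left)
    also have "\<dots> = sj_inner (\<tau> e) (1/2) 1 (1/2) (odd_part_m1 I i e) (P (\<tau> e) (1/2) 1 (1/2) (J div 2 - 1))"
      by (rule sj_inner_commute)
    also have "\<dots> = 0"
    proof (rule sj_orthogonal_lower_degree)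
      have "I div 2 < J div 2 - 1" using True assms(3) by presburger
      then show "degree (odd_part_m1 I i e) < J div 2 - 1" using degree_odd_part_m1[OF e, of I i] by simp
    qed (use \<tau>_gt_1[OF e] orthogonal_P[OF e] in auto)
    finally show ?thesis by (subst sj_inner_commute)
  qed (use assms(3) in \<open>auto simp: odd_part_m1_def[of J]\<close>)
  show ?thesis unfolding gram_m1[OF assms(1,2)] by (intro sum.neutral ballI) (simp only: A B mult_zero_right add_0_right)
qed

lemma gram_m1_CB3: "CB3 n 2 2 1 0 (gram_matrix (basis_m1 P n \<theta>) (basis_m1 P n \<theta>))"
  (is "CB3 _ _ _ _ _ ?M")
proof -
  have band: "?M I J i j = 0" if "\<not> (- int 2 \<le> int J - int I \<and> int J - int I \<le> int 2)"
    "i \<in> {1..n}" "j \<in> {1..n}" for I J i j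
  proof -
    from that(1) have "J > I + 2 \<or> I > J + 2" by linarith
    then show ?thesis
      using gram_m1_banded_aux[OF that(2,3), of I J] gram_m1_banded_aux[OF that(3,2), of J I]
        gram_m1_commute[of I J i j] by auto
  qed
  have corner: "cyclic_banded n (1 + 0) (1 + 0) (?M 0 0)"
    unfolding cyclic_banded_def
    by (auto intro!: gram_m1_not_supported simp: supported_def elem_prev_def split: if_splits)
  \<comment> \<open>A hat function meets a function living on one element only if that element is
    \<open>i\<close> or its predecessor. This is the diagonal, the subdiagonal and the corner entry
    \<open>(1, n)\<close>; symmetry gives the first block column.\<close>
  have row: "?M 0 J i j = 0" if "J \<ge> 1" "i \<in> {1..n}" "j \<in> {1..n}" "j \<noteq> i" "j \<noteq> elem_prev n i" for i j J
    using that by (intro gram_m1_not_supported) (auto simp: supported_def)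
  have rows: "cyclic_banded n 1 0 (?M 0 J)" if "J \<ge> 1" for J
    unfolding cyclic_banded_def
    by (auto intro!: row that simp: elem_prev_def split: if_splits)
  have cols: "cyclic_banded n 0 1 (?M I 0)" if "I \<ge> 1" for I
    unfolding cyclic_banded_def gram_m1_commute[of I 0]
    by (auto intro!: row that simp: elem_prev_def split: if_splits)
  have diag: "?M I J i j = 0" if "I \<ge> 1" "J \<ge> 1" "i \<in> {1..n}" "j \<in> {1..n}" "i \<noteq> j" for I J i j
    using that by (intro gram_m1_not_supported) (auto simp: supported_def)
  show ?thesis
    unfolding CB3_def using band corner rows cols diag by blast
qed

section \<open>The connection matrix: existence and band pattern\<close>

text \<open>Degrees \<open>m\<close> and \<open>m + 1\<close> of the same parity sit two blocks
  apart, on either side of block \<open>J\<close>. The final conjunct fixes zero coefficients off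
  the support, from which the cyclic pattern is read off.\<close>

lemma basis_m1_two_term:
  assumes e: "e \<in> {1..n}" and j: "j \<in> {1..n}"
  shows "\<exists>\<alpha> \<beta>. even_part_m1 J j e = smult \<alpha> (even_part_0 (J - 1) e) + smult \<beta> (even_part_0 (J + 1) e) \<and>
               odd_part_m1 J j e = smult \<alpha> (odd_part_0 (J - 1) e) + smult \<beta> (odd_part_0 (J + 1) e) \<and>
               (\<not> supported J j e \<longrightarrow> \<alpha> = 0 \<and> \<beta> = 0)"
proof (cases "supported J j e")
  case False
  then show ?thesis by (intro exI[of _ 0]) (simp add: not_supported)
next
  case True
  consider "J = 0" | m where "J = 2 * m + 1" | m where "J = 2 * m + 2"
    by (metis Suc_eq_plus1 add_2_eq_Suc' evenE mult_2 mult_Suc_right nat.exhaust oddE)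
  then show ?thesis
  proof cases
    \<comment> \<open>Truncated subtraction makes \<open>J - 1 = 0\<close>, so the formula fits the
      hat: half the constant of block 0 plus a multiple of the sine in block 1.\<close>
    case 1
    have "P (\<tau> e) (-1/2) 0 (-1/2) 0 = 1" "P (\<tau> e) (1/2) 0 (1/2) 0 = 1"
      using orthogonal_P[OF e, of "-1/2" 0 "-1/2"] orthogonal_P[OF e, of "1/2" 0 "1/2"]
      by (auto simp: sj_orthogonal_def)
    then show ?thesis
      using 1 True
      by (intro exI[of _ "1/2"] exI[of _ "coeff (odd_part_m1 J j e) 0"])
         (auto simp: even_part_m1_def odd_part_m1_def even_part_0_def odd_part_0_def)
  next
    case (2 m)
    from sj_raise_b_two_term[OF \<tau>_gt_1[OF e] _ orthogonal_P[OF e] orthogonal_P[OF e], of "-1/2" "-1/2" m]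
    obtain \<alpha> \<beta> where "[:1, -1:] * P (\<tau> e) (-1/2) 1 (-1/2) m =
        smult \<alpha> (P (\<tau> e) (-1/2) 0 (-1/2) m) + smult \<beta> (P (\<tau> e) (-1/2) 0 (-1/2) (Suc m))"
      by auto
    then show ?thesis
      using 2 True
      by (intro exI[of _ \<alpha>] exI[of _ \<beta>])
         (auto simp: even_part_m1_def odd_part_m1_def even_part_0_def odd_part_0_def
                     supported_def simp del: mult_pCons_left)
  next
    case (3 m)
    from sj_raise_b_two_term[OF \<tau>_gt_1[OF e] _ orthogonal_P[OF e] orthogonal_P[OF e], of "1/2" "1/2" m]
    obtain \<alpha> \<beta> where "[:1, -1:] * P (\<tau> e) (1/2) 1 (1/2) m =
        smult \<alpha> (P (\<tau> e) (1/2) 0 (1/2) m) + smult \<beta> (P (\<tau> e) (1/2) 0 (1/2) (Suc m))"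
      by auto
    then show ?thesis
      using 3 True
      by (intro exI[of _ \<alpha>] exI[of _ \<beta>])
         (auto simp: even_part_m1_def odd_part_m1_def even_part_0_def odd_part_0_def
                     supported_def simp del: mult_pCons_left)
  qed
qed

lemma arc_fun_sum:
  "arc_fun r (\<Sum>k\<in>S. smult (c k) (A k)) (\<Sum>k\<in>S. smult (c k) (B k)) x = (\<Sum>k\<in>S. arc_fun r (A k) (B k) x * c k)"
  by (simp add: arc_fun_def poly_sum sum.distrib sum_distrib_left algebra_simps)

lemma connection_matrix_exists:
  "\<exists>R. connection_matrix n \<theta> (basis_0 P \<theta>) (basis_m1 P n \<theta>) R \<and> CB3 n 1 1 1 0 R"
proof -
  have "\<forall>J e j. \<exists>\<alpha> \<beta>. e \<in> {1..n} \<longrightarrow> j \<in> {1..n} \<longrightarrow>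
               even_part_m1 J j e = smult \<alpha> (even_part_0 (J - 1) e) + smult \<beta> (even_part_0 (J + 1) e) \<and>
               odd_part_m1 J j e = smult \<alpha> (odd_part_0 (J - 1) e) + smult \<beta> (odd_part_0 (J + 1) e) \<and>
               (\<not> supported J j e \<longrightarrow> \<alpha> = 0 \<and> \<beta> = 0)"
    using basis_m1_two_term by blast
  then obtain \<alpha> \<beta> where \<alpha>\<beta>: "\<And>J e j. e \<in> {1..n} \<Longrightarrow> j \<in> {1..n} \<Longrightarrow>
               even_part_m1 J j e = smult (\<alpha> J e j) (even_part_0 (J - 1) e) + smult (\<beta> J e j) (even_part_0 (J + 1) e) \<and>
               odd_part_m1 J j e = smult (\<alpha> J e j) (odd_part_0 (J - 1) e) + smult (\<beta> J e j) (odd_part_0 (J + 1) e) \<and>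
               (\<not> supported J j e \<longrightarrow> \<alpha> J e j = 0 \<and> \<beta> J e j = 0)"
    by metis
  define R where "R = (\<lambda>I J i j. if i \<in> {1..n} \<and> j \<in> {1..n} then
       if I = J - 1 then \<alpha> J i j else if I = J + 1 then \<beta> J i j else 0 else 0)"
  have supp: "R I J i j = 0" if "\<not> supported J j i" for I J i j
    using that \<alpha>\<beta>[of i j J] by (auto simp: R_def)
  have range: "{I. \<exists>i\<in>{1..n}. R I J i j \<noteq> 0} \<subseteq> {J - 1, J + 1}" for J j
    by (auto simp: R_def split: if_splits)
  have "connection_matrix n \<theta> (basis_0 P \<theta>) (basis_m1 P n \<theta>) R"
    unfolding connection_matrix_def
  proof (intro conjI allI ballI impI)
    show "R I J i j = 0" if "i \<notin> {1..n} \<or> j \<notin> {1..n}" for I J i j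
      using that by (auto simp: R_def)
    show "finite {I. \<exists>i\<in>{1..n}. R I J i j \<noteq> 0}" for J j
      using range by (rule finite_subset) auto
    fix J j x assume j: "j \<in> {1..n}" and "x \<in> (\<Union>e\<in>{1..n}. interior (elem \<theta> e))"
    then obtain e where e: "e \<in> {1..n}" "\<theta> e < x" "x < \<theta> (e + 1)"
      by (auto simp: elem_def interior_atLeastAtMost_real)
    let ?y = "elem_shift \<theta> e x"
    have local: "(\<Sum>i=1..n. basis_0 P \<theta> I i x * R I J i j)
       = arc_fun (h e) (even_part_0 I e) (odd_part_0 I e) ?y * R I J e j" for I
    proof -
      have "(\<Sum>i=1..n. basis_0 P \<theta> I i x * R I J i j)
         = (\<Sum>i=1..n. if i = e then arc_fun (h e) (even_part_0 I e) (odd_part_0 I e) ?y * R I J e j else 0)"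
        by (intro sum.cong) (auto simp: basis_0_on_elem[OF e])
      then show ?thesis using e by simp
    qed
    have "(\<Sum>I\<in>{I. \<exists>i\<in>{1..n}. R I J i j \<noteq> 0}. \<Sum>i=1..n. basis_0 P \<theta> I i x * R I J i j)
        = (\<Sum>I\<in>{J - 1, J + 1}. \<Sum>i=1..n. basis_0 P \<theta> I i x * R I J i j)"
      by (rule sum.mono_neutral_left[OF _ range]) (auto intro!: sum.neutral)
    also have "\<dots> = (\<Sum>I\<in>{J - 1, J + 1}. arc_fun (h e) (even_part_0 I e) (odd_part_0 I e) ?y * R I J e j)"
      by (simp only: local)
    also have "\<dots> = arc_fun (h e) (\<Sum>I\<in>{J - 1, J + 1}. smult (R I J e j) (even_part_0 I e))
                                  (\<Sum>I\<in>{J - 1, J + 1}. smult (R I J e j) (odd_part_0 I e)) ?y"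
      by (rule arc_fun_sum[symmetric])
    also have "\<dots> = arc_fun (h e) (even_part_m1 J j e) (odd_part_m1 J j e) ?y"
      using \<alpha>\<beta>[OF e(1) j, of J] e(1) j by (simp add: R_def)
    finally show "basis_m1 P n \<theta> J j x =
        (\<Sum>I\<in>{I. \<exists>i\<in>{1..n}. R I J i j \<noteq> 0}. \<Sum>i=1..n. basis_0 P \<theta> I i x * R I J i j)"
      using basis_m1_on_elem[OF e j, of J] by simp
  qed
  moreover have "CB3 n 1 1 1 0 R"
  proof -
    have band: "R I J i j = 0" if "\<not> (- int 1 \<le> int J - int I \<and> int J - int I \<le> int 1)" for I J i j
      using that by (auto simp: R_def)
    have diag: "R I J i j = 0" if "J \<ge> 1" "i \<noteq> j" for I J i j
      using that by (intro supp) (auto simp: supported_def)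
    have col: "R I 0 i j = 0" if "i \<noteq> j" "i \<noteq> elem_prev n j" for I i j
      using that by (intro supp) (auto simp: supported_def)
    have "cyclic_banded n (1 + 0) (1 + 0) (R 0 0)" "cyclic_banded n 0 1 (R I 0)" for I
      unfolding cyclic_banded_def by (auto intro!: col simp: elem_prev_def split: if_splits)
    \<comment> \<open>From \<open>J = 1\<close> on every function lives on one element, so these
      blocks are even diagonal.\<close>
    moreover have "cyclic_banded n 1 0 (R 0 J)" if "J \<ge> 1" for J
      unfolding cyclic_banded_def by (auto intro!: diag that)
    ultimately show ?thesis
      unfolding CB3_def using band diag by blast
  qed
  ultimately show ?thesis by blast
qed

section \<open>The connection matrix: uniqueness\<close>

text \<open>For an arbitrary connection matrix, the equality of functions inside element
  \<open>e\<close> splits into equalities of polynomials, because the pair of parts is unique by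
  \<open>arc_fun_eq_0\<close>.\<close>

lemma connection_matrix_local:
  assumes R: "connection_matrix n \<theta> (basis_0 P \<theta>) (basis_m1 P n \<theta>) R"
    and e: "e \<in> {1..n}" and j: "j \<in> {1..n}"
  defines "S \<equiv> \<lambda>J. {I. \<exists>i\<in>{1..n}. R I J i j \<noteq> 0}"
  shows "even_part_m1 J j e = (\<Sum>I\<in>S J. smult (R I J e j) (even_part_0 I e))"
    "odd_part_m1 J j e = (\<Sum>I\<in>S J. smult (R I J e j) (odd_part_0 I e))"
proof -
  have zero: "arc_fun (h e) (even_part_m1 J j e - (\<Sum>I\<in>S J. smult (R I J e j) (even_part_0 I e)))
          (odd_part_m1 J j e - (\<Sum>I\<in>S J. smult (R I J e j) (odd_part_0 I e))) y = 0"
    if "- half_length \<theta> e < y" "y < half_length \<theta> e" for y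
  proof -
    define x where "x = y + (\<theta> e + \<theta> (e + 1)) / 2"
    have y: "elem_shift \<theta> e x = y" by (simp add: x_def elem_shift_def)
    have x: "\<theta> e < x" "x < \<theta> (e + 1)" using that by (auto simp: x_def half_length_def field_simps)
    have "x \<in> (\<Union>e\<in>{1..n}. interior (elem \<theta> e))"
      using e x by (auto simp: elem_def interior_atLeastAtMost_real)
    then have "basis_m1 P n \<theta> J j x = (\<Sum>I\<in>S J. \<Sum>i=1..n. basis_0 P \<theta> I i x * R I J i j)"
      using R j unfolding connection_matrix_def S_def by blast
    also have "\<dots> = (\<Sum>I\<in>S J. \<Sum>i=1..n. if i = e then arc_fun (h e) (even_part_0 I e) (odd_part_0 I e) y * R I J e j else 0)"
      by (intro sum.cong) (auto simp: basis_0_on_elem[OF e x] y)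
    also have "\<dots> = (\<Sum>I\<in>S J. arc_fun (h e) (even_part_0 I e) (odd_part_0 I e) y * R I J e j)"
      using e by simp
    finally have "arc_fun (h e) (even_part_m1 J j e) (odd_part_m1 J j e) y =
        arc_fun (h e) (\<Sum>I\<in>S J. smult (R I J e j) (even_part_0 I e)) (\<Sum>I\<in>S J. smult (R I J e j) (odd_part_0 I e)) y"
      by (simp add: basis_m1_on_elem[OF e x j] y arc_fun_sum)
    then show ?thesis by (simp add: arc_fun_def algebra_simps)
  qed
  show "even_part_m1 J j e = (\<Sum>I\<in>S J. smult (R I J e j) (even_part_0 I e))"
    "odd_part_m1 J j e = (\<Sum>I\<in>S J. smult (R I J e j) (odd_part_0 I e))"
    using arc_fun_eq_0[OF half_length_bounds[OF e] refl zero] by auto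
qed

text \<open>Testing the expansion against block \<open>I\<close> isolates one entry: the other
  blocks are orthogonal to it or have a zero part of this parity.\<close>

lemma connection_matrix_coefficient:
  assumes R: "connection_matrix n \<theta> (basis_0 P \<theta>) (basis_m1 P n \<theta>) R"
    and i: "i \<in> {1..n}" and j: "j \<in> {1..n}"
  shows "even I \<Longrightarrow> sj_inner (\<tau> i) (-1/2) 0 (-1/2) (even_part_m1 J j i) (even_part_0 I i)
            = R I J i j * sj_inner (\<tau> i) (-1/2) 0 (-1/2) (even_part_0 I i) (even_part_0 I i)"
    and "odd I \<Longrightarrow> sj_inner (\<tau> i) (1/2) 0 (1/2) (odd_part_m1 J j i) (odd_part_0 I i)
            = R I J i j * sj_inner (\<tau> i) (1/2) 0 (1/2) (odd_part_0 I i) (odd_part_0 I i)"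
proof -
  let ?S = "{I. \<exists>i\<in>{1..n}. R I J i j \<noteq> 0}"
  have S: "finite ?S" using R j by (auto simp: connection_matrix_def)
  \<comment> \<open>If \<open>I\<close> is not in the index set, then \<open>R I J i j = 0\<close>
    and both sides vanish.\<close>
  have *: "(\<Sum>K\<in>?S. R K J i j * v K) = R I J i j * v I" if "\<And>K. K \<noteq> I \<Longrightarrow> v K = 0" for v :: "nat \<Rightarrow> real"
  proof -
    have "(\<Sum>K\<in>?S. R K J i j * v K) = (\<Sum>K\<in>?S. if K = I then R I J i j * v I else 0)"
      using that by (intro sum.cong) auto
    also have "\<dots> = R I J i j * v I"
      using S i by auto
    finally show ?thesis .
  qed
  note t = \<tau>_gt_1[OF i]
  show "sj_inner (\<tau> i) (-1/2) 0 (-1/2) (even_part_m1 J j i) (even_part_0 I i)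
            = R I J i j * sj_inner (\<tau> i) (-1/2) 0 (-1/2) (even_part_0 I i) (even_part_0 I i)" if "even I"
  proof -
    have orth: "sj_inner (\<tau> i) (-1/2) 0 (-1/2) (even_part_0 K i) (even_part_0 I i) = 0" if "K \<noteq> I" for K
      using that \<open>even I\<close> orthogonal_P[OF i, of "-1/2" 0 "-1/2"]
      by (auto simp: even_part_0_def sj_orthogonal_def elim!: evenE)
    have expand: "sj_inner (\<tau> i) (-1/2) 0 (-1/2) (even_part_m1 J j i) (even_part_0 I i)
        = (\<Sum>K\<in>?S. R K J i j * sj_inner (\<tau> i) (-1/2) 0 (-1/2) (even_part_0 K i) (even_part_0 I i))"
      unfolding connection_matrix_local(1)[OF R i j] using t
      by (simp add: sj_inner_sum_left sj_inner_smult_left)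
    show ?thesis unfolding expand by (rule *) (rule orth)
  qed
  show "sj_inner (\<tau> i) (1/2) 0 (1/2) (odd_part_m1 J j i) (odd_part_0 I i)
            = R I J i j * sj_inner (\<tau> i) (1/2) 0 (1/2) (odd_part_0 I i) (odd_part_0 I i)" if "odd I"
  proof -
    have orth: "sj_inner (\<tau> i) (1/2) 0 (1/2) (odd_part_0 K i) (odd_part_0 I i) = 0" if "K \<noteq> I" for K
      using that \<open>odd I\<close> orthogonal_P[OF i, of "1/2" 0 "1/2"]
      by (auto simp: odd_part_0_def sj_orthogonal_def elim!: oddE)
    have expand: "sj_inner (\<tau> i) (1/2) 0 (1/2) (odd_part_m1 J j i) (odd_part_0 I i)
        = (\<Sum>K\<in>?S. R K J i j * sj_inner (\<tau> i) (1/2) 0 (1/2) (odd_part_0 K i) (odd_part_0 I i))"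
      unfolding connection_matrix_local(2)[OF R i j] using t
      by (simp add: sj_inner_sum_left sj_inner_smult_left)
    show ?thesis unfolding expand by (rule *) (rule orth)
  qed
qed

text \<open>Each entry is an inner product independent of \<open>R\<close> divided by a positive
  squared norm.\<close>

lemma connection_matrix_unique:
  assumes R: "connection_matrix n \<theta> (basis_0 P \<theta>) (basis_m1 P n \<theta>) R"
    and R': "connection_matrix n \<theta> (basis_0 P \<theta>) (basis_m1 P n \<theta>) R'"
  shows "R = R'"
proof (intro ext)
  fix I J i j
  show "R I J i j = R' I J i j"
  proof (cases "i \<in> {1..n} \<and> j \<in> {1..n}")
    case True
    then have i: "i \<in> {1..n}" and j: "j \<in> {1..n}" by auto
    show ?thesis
    proof (cases "even I")
      case True
      have "sj_inner (\<tau> i) (-1/2) 0 (-1/2) (even_part_0 I i) (even_part_0 I i) > 0"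
        using True sj_orthogonal_norm_pos[OF \<tau>_gt_1[OF i] _ _ orthogonal_P[OF i], of "-1/2" 0 "-1/2"]
        by (simp add: even_part_0_def)
      then show ?thesis
        using connection_matrix_coefficient(1)[OF R i j True, of J]
          connection_matrix_coefficient(1)[OF R' i j True, of J]
        by auto
    next
      case False
      have "sj_inner (\<tau> i) (1/2) 0 (1/2) (odd_part_0 I i) (odd_part_0 I i) > 0"
        using False sj_orthogonal_norm_pos[OF \<tau>_gt_1[OF i] _ _ orthogonal_P[OF i], of "1/2" 0 "1/2"]
        by (simp add: odd_part_0_def)
      then show ?thesis
        using connection_matrix_coefficient(2)[OF R i j False, of J]
          connection_matrix_coefficient(2)[OF R' i j False, of J]
        by auto
    qed
  next
    case False
    then show ?thesis using R R' unfolding connection_matrix_def by metis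
  qed
qed

end

theorem proposition10:
  fixes P :: "real \<Rightarrow> real \<Rightarrow> real \<Rightarrow> real \<Rightarrow> nat \<Rightarrow> real poly"
    and n :: nat and \<theta> :: "nat \<Rightarrow> real"
  assumes "semiclassical_jacobi P"
    and "n \<ge> 2"
    and "grid n \<theta>"
  shows "(\<exists>!R. connection_matrix n \<theta> (basis_0 P \<theta>) (basis_m1 P n \<theta>) R) \<and>
         (\<forall>R. connection_matrix n \<theta> (basis_0 P \<theta>) (basis_m1 P n \<theta>) R \<longrightarrow> CB3 n 1 1 1 0 R) \<and>
         CB3 n 2 2 1 0 (gram_matrix (basis_m1 P n \<theta>) (basis_m1 P n \<theta>))"
proof -
  interpret arc_grid P n \<theta> by unfold_locales (use assms in auto)
  \<comment> \<open>Uniqueness carries the band pattern of the constructed matrix over to every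
    connection matrix.\<close>
  from connection_matrix_exists connection_matrix_unique gram_m1_CB3 show ?thesis by metis
qed

end
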